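(* Let $X$ be a real separable Hilbert space with inner product $\langle\cdot,\cdot\rangle$, let $\mathcal{C}:X\to X$ be a trace-class, symmetric, strictly positive definite linear operator, and let $\mu_0=N(0,\mathcal{C})$ be the centered Gaussian measure on $X$ with covariance $\mathcal{C}$. Let $\Phi:X\to\mathbb{R}$ be measurable with $e^{-\Phi}$ $\mu_0$-integrable, and let $$\mu(dq)=\frac1Z e^{-\Phi(q)}\mu_0(dq),\qquad Z=\int_Xe^{-\Phi(q)}\mu_0(dq).$$ Fix $\rho\in[0,1]$ and an integer $p\ge 1$. Let $Q(q,\cdot)$ be the law of $\rho q+\sqrt{1-\rho^2}\,w$ with $w\sim\mu_0$, and define the Markov kernel from $X$ to $X^p$ $$\mathcal{V}(q_0,dq_1,\dots,dq_p)=\int_X\prod_{k=1}^pQ(q,dq_k)\,Q(q_0,dq),$$ and for $(q_0,v)=(q_0,q_1,\dots,q_p)\in X\times X^p$ let $$\alpha_j(q_0,v)=\frac{\exp(-\Phi(q_j))}{\sum_{k=0}^p\exp(-\Phi(q_k))},\qquad j=0,\dots,p.$$ Then the Markov kernel (the multiproposal preconditioned Crank–Nicolson kernel) $$P(q_0,d\tilde q)=\sum_{j=0}^p\int_{X^p}\alpha_j(q_0,q_1,\dots,q_p)\,\delta_{q_j}(d\tilde q)\,\mathcal{V}(q_0,dq_1,\dots,dq_p)$$ satisfies detailed balance with respect to $\mu$, i.e. $P(q,d\tilde q)\,\mu(dq)=P(\tilde q,dq)\,\mu(d\tilde q)$ as measures on $X\times X$; in particular $\mu$ is invariant under $P$.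
   Context: $X$ carries its Borel $\sigma$-algebra. $\mu_0=N(0,\mathcal{C})$ is the Borel probability measure on $X$ with characteristic function $\int_Xe^{i\langle\xi,q\rangle}\mu_0(dq)=e^{-\frac12\langle\mathcal{C}\xi,\xi\rangle}$, $\xi\in X$. *)

theory Defs
  imports "HOL-Probability.Probability"
begin

text \<open>A real separable Hilbert space is a type of sort \<open>{real_inner, polish_space}\<close>, i.e. a complete
  second-countable real inner product space.\<close>

definition symmetric_operator :: "('a::real_inner \<Rightarrow> 'a) \<Rightarrow> bool" where
  "symmetric_operator T \<longleftrightarrow> (\<forall>x y. T x \<bullet> y = x \<bullet> T y)"

definition strictly_positive_operator :: "('a::real_inner \<Rightarrow> 'a) \<Rightarrow> bool" where
  "strictly_positive_operator T \<longleftrightarrow> (\<forall>x. x \<noteq> 0 \<longrightarrow> T x \<bullet> x > 0)"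

definition orthonormal_basis :: "'a::real_inner set \<Rightarrow> bool" where
  "orthonormal_basis E \<longleftrightarrow>
     pairwise orthogonal E \<and> (\<forall>e\<in>E. norm e = 1) \<and> closure (span E) = UNIV"

text \<open>\<open>A\<close> is the absolute value of \<open>T\<close>: the positive square root of \<open>T* T\<close>. As \<open>A\<close> is symmetric, the
  last conjunct is \<open>A A = T* T\<close>, stated without introducing the adjoint.\<close>

definition is_operator_abs :: "('a::real_inner \<Rightarrow> 'a) \<Rightarrow> ('a \<Rightarrow> 'a) \<Rightarrow> bool" where
  "is_operator_abs T A \<longleftrightarrow>
     bounded_linear A \<and> symmetric_operator A \<and> (\<forall>x. A x \<bullet> x \<ge> 0) \<and>
     (\<forall>x y. A x \<bullet> A y = T x \<bullet> T y)"

definition trace_class :: "('a::real_inner \<Rightarrow> 'a) \<Rightarrow> bool" where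
  "trace_class T \<longleftrightarrow> bounded_linear T \<and>
     (\<exists>A E. is_operator_abs T A \<and> orthonormal_basis E \<and> (\<lambda>e. A e \<bullet> e) summable_on E)"

definition centered_gaussian ::
    "('a::{real_inner, polish_space} \<Rightarrow> 'a) \<Rightarrow> 'a measure \<Rightarrow> bool" where
  "centered_gaussian C \<mu>\<^sub>0 \<longleftrightarrow>
     prob_space \<mu>\<^sub>0 \<and> sets \<mu>\<^sub>0 = sets borel \<and>
     (\<forall>\<xi>. (CLINT q|\<mu>\<^sub>0. iexp (\<xi> \<bullet> q)) = exp (complex_of_real (- (1/2) * (C \<xi> \<bullet> \<xi>))))"

definition target_measure :: "'a measure \<Rightarrow> ('a \<Rightarrow> real) \<Rightarrow> 'a measure" where
  "target_measure \<mu>\<^sub>0 \<Phi> =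
     (let Z = (LINT q|\<mu>\<^sub>0. exp (- \<Phi> q)) in density \<mu>\<^sub>0 (\<lambda>q. ennreal (1 / Z * exp (- \<Phi> q))))"

definition pcn_proposal ::
    "'a::{real_inner, polish_space} measure \<Rightarrow> real \<Rightarrow> 'a \<Rightarrow> 'a measure" where
  "pcn_proposal \<mu>\<^sub>0 \<rho> q = distr \<mu>\<^sub>0 borel (\<lambda>w. \<rho> *\<^sub>R q + sqrt (1 - \<rho>\<^sup>2) *\<^sub>R w)"

text \<open>The space \<open>X\<^sup>p\<close> is the product \<open>\<Pi>\<^sub>M k\<in>{1..p}. borel\<close>; a point \<open>v = (q\<^sub>1, \<dots>, q\<^sub>p)\<close>
  is a function on \<open>{1..p}\<close>.\<close>

definition mpcn_proposal ::
    "'a::{real_inner, polish_space} measure \<Rightarrow> real \<Rightarrow> nat \<Rightarrow> 'a \<Rightarrow> (nat \<Rightarrow> 'a) measure" where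
  "mpcn_proposal \<mu>\<^sub>0 \<rho> p q\<^sub>0 =
     pcn_proposal \<mu>\<^sub>0 \<rho> q\<^sub>0 \<bind> (\<lambda>q. \<Pi>\<^sub>M k\<in>{1..p}. pcn_proposal \<mu>\<^sub>0 \<rho> q)"

text \<open>\<open>v(0 := q\<^sub>0)\<close> is the tuple \<open>(q\<^sub>0, q\<^sub>1, \<dots>, q\<^sub>p)\<close>.\<close>

definition mpcn_accept ::
    "('a \<Rightarrow> real) \<Rightarrow> nat \<Rightarrow> nat \<Rightarrow> 'a \<Rightarrow> (nat \<Rightarrow> 'a) \<Rightarrow> real" where
  "mpcn_accept \<Phi> p j q\<^sub>0 v =
     exp (- \<Phi> ((v(0 := q\<^sub>0)) j)) / (\<Sum>k=0..p. exp (- \<Phi> ((v(0 := q\<^sub>0)) k)))"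

text \<open>The Dirac measure at \<open>x\<close> is \<open>return borel x\<close>.\<close>

definition mpcn_kernel ::
    "'a::{real_inner, polish_space} measure \<Rightarrow> ('a \<Rightarrow> real) \<Rightarrow> real \<Rightarrow> nat \<Rightarrow> 'a \<Rightarrow> 'a measure" where
  "mpcn_kernel \<mu>\<^sub>0 \<Phi> \<rho> p q\<^sub>0 =
     measure_of UNIV (sets borel)
       (\<lambda>A. \<Sum>j=0..p. \<integral>\<^sup>+v. ennreal (mpcn_accept \<Phi> p j q\<^sub>0 v) *
                emeasure (return borel ((v(0 := q\<^sub>0)) j)) A \<partial>mpcn_proposal \<mu>\<^sub>0 \<rho> p q\<^sub>0)"

definition markov_kernel :: "'a measure \<Rightarrow> 'b measure \<Rightarrow> ('a \<Rightarrow> 'b measure) \<Rightarrow> bool" where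
  "markov_kernel M N K \<longleftrightarrow> K \<in> M \<rightarrow>\<^sub>M prob_algebra N"

text \<open>Both sides are laws of \<open>(q, q')\<close> on \<open>X \<times> X\<close>: on the left \<open>q\<close> is drawn from \<open>\<mu>\<close> and \<open>q'\<close> from
  \<open>P q\<close>, on the right \<open>q'\<close> is drawn from \<open>\<mu>\<close> and \<open>q\<close> from \<open>P q'\<close>.\<close>

definition detailed_balance :: "'a::topological_space measure \<Rightarrow> ('a \<Rightarrow> 'a measure) \<Rightarrow> bool" where
  "detailed_balance \<mu> P \<longleftrightarrow>
     \<mu> \<bind> (\<lambda>q. P q \<bind> (\<lambda>q'. return (borel \<Otimes>\<^sub>M borel) (q, q'))) =
     \<mu> \<bind> (\<lambda>q'. P q' \<bind> (\<lambda>q. return (borel \<Otimes>\<^sub>M borel) (q, q')))"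

definition invariant_measure :: "'a measure \<Rightarrow> ('a \<Rightarrow> 'a measure) \<Rightarrow> bool" where
  "invariant_measure \<mu> P \<longleftrightarrow> \<mu> \<bind> P = \<mu>"

end

theory Submission
  imports Defs
begin

text \<open>
  The map \<open>(q, w) \<mapsto> (\<rho> q + \<sigma> w, \<sigma> q - \<rho> w)\<close> with \<open>\<sigma> = sqrt (1 - \<rho>\<^sup>2)\<close> is an orthogonal involution which
  preserves the characteristic function of \<open>\<mu>\<^sub>0 \<otimes> \<mu>\<^sub>0\<close>, hence \<open>\<mu>\<^sub>0 \<otimes> \<mu>\<^sub>0\<close> itself; this is reversibility of
  \<open>Q\<close> with respect to \<open>\<mu>\<^sub>0\<close>. If \<open>q\<^sub>0\<close> has law \<open>\<mu>\<^sub>0\<close> and the pivot \<open>q\<close> has law \<open>Q q\<^sub>0\<close>, then by reversibility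
  \<open>q\<close> has law \<open>\<mu>\<^sub>0\<close> and \<open>q\<^sub>0, \<dots>, q\<^sub>p\<close> are i.i.d. with law \<open>Q q\<close> given \<open>q\<close>, hence exchangeable. The weight
  \<open>exp (- \<Phi> q\<^sub>0) \<alpha>\<^sub>j\<close> is invariant under swapping \<open>q\<^sub>0\<close> and \<open>q\<^sub>j\<close>, which gives detailed balance term by term.

  Uniqueness for characteristic functions reduces to the one-dimensional theorem: agreement of the
  characteristic functions of \<open>M\<close> and \<open>N\<close> survives restriction to a half-space, and finite intersections
  of half-spaces form a generator of the Borel sets that is stable under intersection.
\<close>

section \<open>Uniqueness of characteristic functions on separable inner product spaces\<close>

text \<open>At \<open>t = 0\<close> the hypothesis makes the total masses agree. If this common mass
  \<open>c\<close> is 0, both measures vanish; otherwise division by \<open>c\<close> gives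
  probability measures, to which \<open>Levy_uniqueness\<close> applies.\<close>

lemma finite_Levy_uniqueness:
  fixes M N :: "real measure"
  assumes "finite_measure M" "finite_measure N"
    and sets: "sets M = sets borel" "sets N = sets borel"
    and char: "\<And>t. char M t = char N t"
  shows "M = N"
proof -
  interpret M: finite_measure M by fact
  interpret N: finite_measure N by fact
  have space: "space M = UNIV" "space N = UNIV"
    using sets[THEN sets_eq_imp_space_eq] by auto
  define c where "c = measure M UNIV"
  have c: "c = measure N UNIV"
    using char[of 0] by (simp add: char_def c_def space)
  show ?thesis
  proof (cases "c = 0")
    case True
    show ?thesis
    proof (rule measure_eqI)
      fix A assume "A \<in> sets M"
      have "emeasure M A \<le> emeasure M UNIV" "emeasure N A \<le> emeasure N UNIV"
        using sets by (auto intro!: emeasure_mono)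
      moreover have "emeasure M UNIV = 0" "emeasure N UNIV = 0"
        using True c by (simp_all add: c_def M.emeasure_eq_measure N.emeasure_eq_measure)
      ultimately show "emeasure M A = emeasure N A" by simp
    qed (simp add: sets)
  next
    case False
    hence pos: "c > 0" by (simp add: c_def zero_less_measure_iff)
    have *: "real_distribution (density K (\<lambda>_. ennreal (1 / c)))"
        "char (density K (\<lambda>_. ennreal (1 / c))) t = char K t / c"
      if K: "finite_measure K" "sets K = sets borel" "measure K UNIV = c" for K t
    proof -
      interpret K: finite_measure K by fact
      have "emeasure K UNIV = ennreal c" by (simp add: K.emeasure_eq_measure K)
      moreover have "space K = UNIV" using K(2)[THEN sets_eq_imp_space_eq] by auto
      ultimately show "real_distribution (density K (\<lambda>_. ennreal (1 / c)))"
        using K(2) pos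
        by (intro real_distribution.intro real_distribution_axioms.intro prob_spaceI)
           (auto simp: emeasure_density ennreal_mult[symmetric])
      note K(2)[measurable_cong]
      show "char (density K (\<lambda>_. ennreal (1 / c))) t = char K t / c"
        using pos unfolding char_def
        by (subst integral_density; (measurable; fail)?) (auto simp: scaleR_conv_of_real)
    qed
    have eq: "density M (\<lambda>_. ennreal (1 / c)) = density N (\<lambda>_. ennreal (1 / c))"
      using *[OF assms(1) sets(1) c_def[symmetric]] *[OF assms(2) sets(2) c[symmetric]] char
      by (intro Levy_uniqueness ext) simp_all
    show ?thesis
    proof (rule measure_eqI)
      fix A assume A: "A \<in> sets M"
      have "ennreal (1 / c) * emeasure M A = ennreal (1 / c) * emeasure N A"
        using arg_cong[OF eq, of "\<lambda>K. emeasure K A"] A sets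
        by (simp add: emeasure_density nn_integral_cmult_indicator)
      thus "emeasure M A = emeasure N A"
        using pos by (simp add: M.emeasure_eq_measure N.emeasure_eq_measure ennreal_mult[symmetric])
    qed (simp add: sets)
  qed
qed

section \<open>Restriction of characteristic functions to half-spaces\<close>

text \<open>The measures with density \<open>w\<close> are pushed forward to the real line along the
  functional given by \<open>\<xi>\<close>. The hypothesis on \<open>char\<close> says that the two
  images have equal characteristic functions, so they coincide, and comparing them on
  \<open>{..a}\<close> gives the claim. The bound \<open>B\<close> keeps the images finite.\<close>

lemma weighted_halfspace_integral_eq:
  fixes M N :: "'a::{real_inner, second_countable_topology} measure"
  assumes "finite_measure M" "finite_measure N"
    and sets: "sets M = sets borel" "sets N = sets borel"
    and w[measurable]: "w \<in> borel_measurable borel"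
    and w_bound: "\<And>x. 0 \<le> w x" "\<And>x. w x \<le> B"
    and char: "\<And>t. (CLINT x|M. w x *\<^sub>R iexp (t * (\<xi> \<bullet> x))) = (CLINT x|N. w x *\<^sub>R iexp (t * (\<xi> \<bullet> x)))"
  shows "(LINT x|M. indicator {x. \<xi> \<bullet> x \<le> a} x * w x) = (LINT x|N. indicator {x. \<xi> \<bullet> x \<le> a} x * w x)"
proof -
  define L where "L K = distr (density K (\<lambda>x. ennreal (w x))) borel (\<lambda>x. \<xi> \<bullet> x)" for K
  have *: "finite_measure (L K)" "sets (L K) = sets borel"
      "char (L K) t = (CLINT x|K. w x *\<^sub>R iexp (t * (\<xi> \<bullet> x)))"
      "measure (L K) {..a} = (LINT x|K. indicator {x. \<xi> \<bullet> x \<le> a} x * w x)"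
    if K: "finite_measure K" "sets K = sets borel" for K t
  proof -
    interpret K: finite_measure K by fact
    note K(2)[measurable_cong]
    have "(\<integral>\<^sup>+x. ennreal (w x) \<partial>K) \<le> (\<integral>\<^sup>+x. ennreal B \<partial>K)"
      using w_bound by (intro nn_integral_mono ennreal_leI)
    also have "\<dots> < \<infinity>"
      by (simp add: ennreal_mult_less_top K.emeasure_eq_measure)
    finally have "finite_measure (density K (\<lambda>x. ennreal (w x)))"
      by (intro finite_measureI) (auto simp: emeasure_density cong: nn_integral_cong)
    thus fin: "finite_measure (L K)"
      unfolding L_def by (rule finite_measure.finite_measure_distr) measurable
    show "sets (L K) = sets borel" by (simp add: L_def)
    show "char (L K) t = (CLINT x|K. w x *\<^sub>R iexp (t * (\<xi> \<bullet> x)))"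
      unfolding char_def L_def using w_bound
      by (subst integral_distr, measurable, subst integral_density) auto
    interpret L: finite_measure "L K" by (rule fin)
    have "measure (L K) {..a} = (LINT x|L K. indicator {..a} x)"
      by (simp add: L_def)
    also have "\<dots> = (LINT x|K. w x *\<^sub>R indicator {..a} (\<xi> \<bullet> x))"
      unfolding L_def using w_bound
      by (subst integral_distr, measurable, subst integral_density) auto
    also have "\<dots> = (LINT x|K. indicator {x. \<xi> \<bullet> x \<le> a} x * w x)"
      by (intro Bochner_Integration.integral_cong) (auto simp: indicator_def)
    finally show "measure (L K) {..a} = (LINT x|K. indicator {x. \<xi> \<bullet> x \<le> a} x * w x)" .
  qed
  have "L M = L N"
    using assms(1-4) char by (intro finite_Levy_uniqueness) (simp_all add: *)
  thus ?thesis using *(4)[of M] *(4)[of N] assms(1-4) by simp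
qed

text \<open>\<open>weighted_halfspace_integral_eq\<close> needs nonnegative weights; the character \<open>iexp (\<eta> \<bullet> x)\<close> is
  recovered from the nonnegative weights \<open>1\<close>, \<open>1 + cos (\<eta> \<bullet> x)\<close> and \<open>1 + sin (\<eta> \<bullet> x)\<close>.\<close>

lemma char_eq_Int_halfspace:
  fixes M N :: "'a::{real_inner, second_countable_topology} measure"
  assumes fin: "finite_measure M" "finite_measure N"
    and sets: "sets M = sets borel" "sets N = sets borel"
    and S[measurable]: "S \<in> sets borel"
    and char: "\<And>\<eta>. (CLINT x|M. indicator S x *\<^sub>R iexp (\<eta> \<bullet> x)) = (CLINT x|N. indicator S x *\<^sub>R iexp (\<eta> \<bullet> x))"
  shows "(CLINT x|M. indicator (S \<inter> {x. \<xi> \<bullet> x \<le> a}) x *\<^sub>R iexp (\<eta> \<bullet> x)) =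
    (CLINT x|N. indicator (S \<inter> {x. \<xi> \<bullet> x \<le> a}) x *\<^sub>R iexp (\<eta> \<bullet> x))"
proof -
  define H where "H = {x. \<xi> \<bullet> x \<le> a}"
  have H[measurable]: "H \<in> sets borel" unfolding H_def by measurable
  define I where "I \<eta> x = indicator S x *\<^sub>R iexp (\<eta> \<bullet> x)" for \<eta> x :: 'a
  have int: "integrable K (\<lambda>x. f x)" if K: "finite_measure K" "sets K = sets borel"
    and f: "f \<in> borel_measurable borel" "\<And>x. norm (f x) \<le> B"
    for K and f :: "'a \<Rightarrow> 'c::{banach, second_countable_topology}" and B
  proof -
    interpret K: finite_measure K by fact
    show ?thesis using f K(2)
      by (intro K.integrable_const_bound[of _ B]) (auto cong: measurable_cong_sets)
  qed
  have intI: "integrable M (I \<eta>)" "integrable N (I \<eta>)" for \<eta>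
    using fin sets unfolding I_def by (auto intro!: int[of _ _ 1] simp: indicator_def)
  \<comment> \<open>Euler's formula turns the cosine and sine weights into frequency shifts by
    \<open>\<eta>\<close> and \<open>- \<eta>\<close>, so the weighted characters are combinations
    of functions \<open>I \<zeta>\<close>, whose integrals agree by assumption.\<close>
  have cosw: "(indicator S x * (1 + cos (\<eta> \<bullet> x))) *\<^sub>R iexp (t * (\<xi> \<bullet> x)) =
      I (t *\<^sub>R \<xi>) x + (I (t *\<^sub>R \<xi> + \<eta>) x + I (t *\<^sub>R \<xi> - \<eta>) x) / 2" for t x
    by (auto simp: I_def indicator_def inner_add_left inner_diff_left exp_eq_polar complex_eq_iff
        cos_add cos_diff sin_add sin_diff algebra_simps)
  have sinw: "(indicator S x * (1 + sin (\<eta> \<bullet> x))) *\<^sub>R iexp (t * (\<xi> \<bullet> x)) =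
      I (t *\<^sub>R \<xi>) x + (I (t *\<^sub>R \<xi> + \<eta>) x - I (t *\<^sub>R \<xi> - \<eta>) x) / (2 * \<i>)" for t x
    by (auto simp: I_def indicator_def inner_add_left inner_diff_left exp_eq_polar complex_eq_iff
        cos_add cos_diff sin_add sin_diff algebra_simps Re_divide Im_divide)
  have ch: "integral\<^sup>L M (I \<zeta>) = integral\<^sup>L N (I \<zeta>)" for \<zeta> unfolding I_def by (rule char)
  have bnd: "\<bar>cos y\<bar> \<le> 1" "\<bar>sin y\<bar> \<le> 1" "0 \<le> 1 + cos y" "0 \<le> 1 + sin y" for y :: real
    using cos_ge_minus_one[of y] sin_ge_minus_one[of y] by (simp_all, linarith+)
  have one: "(LINT x|M. indicator H x * indicator S x) = (LINT x|N. indicator H x * indicator S x :: real)"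
    unfolding H_def using fin sets char[of "t *\<^sub>R \<xi>" for t]
    by (intro weighted_halfspace_integral_eq[where B=1]) (auto simp: indicator_def)
  have c: "(LINT x|M. indicator H x * (indicator S x * (1 + cos (\<eta> \<bullet> x)))) =
      (LINT x|N. indicator H x * (indicator S x * (1 + cos (\<eta> \<bullet> x))))"
    unfolding H_def
  proof (intro weighted_halfspace_integral_eq[where B=2] fin sets)
    show "(CLINT x|M. (indicator S x * (1 + cos (\<eta> \<bullet> x))) *\<^sub>R iexp (t * (\<xi> \<bullet> x))) =
      (CLINT x|N. (indicator S x * (1 + cos (\<eta> \<bullet> x))) *\<^sub>R iexp (t * (\<xi> \<bullet> x)))" for t
      unfolding cosw using intI by (simp add: ch)
  qed (use bnd in \<open>auto simp: indicator_def\<close>)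
  have s: "(LINT x|M. indicator H x * (indicator S x * (1 + sin (\<eta> \<bullet> x)))) =
      (LINT x|N. indicator H x * (indicator S x * (1 + sin (\<eta> \<bullet> x))))"
    unfolding H_def
  proof (intro weighted_halfspace_integral_eq[where B=2] fin sets)
    show "(CLINT x|M. (indicator S x * (1 + sin (\<eta> \<bullet> x))) *\<^sub>R iexp (t * (\<xi> \<bullet> x))) =
      (CLINT x|N. (indicator S x * (1 + sin (\<eta> \<bullet> x))) *\<^sub>R iexp (t * (\<xi> \<bullet> x)))" for t
      unfolding sinw using intI by (simp add: ch)
  qed (use bnd in \<open>auto simp: indicator_def\<close>)
  \<comment> \<open>Subtracting the case of weight 1 from the other two isolates the integrals of
    cosine and sine over \<open>S \<inter> H\<close>, which are the real and imaginary parts of the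
    integrated character.\<close>
  have "(CLINT x|K. indicator (S \<inter> H) x *\<^sub>R iexp (\<eta> \<bullet> x)) =
      of_real ((LINT x|K. indicator H x * (indicator S x * (1 + cos (\<eta> \<bullet> x)))) -
        (LINT x|K. indicator H x * indicator S x)) +
      \<i> * of_real ((LINT x|K. indicator H x * (indicator S x * (1 + sin (\<eta> \<bullet> x)))) -
        (LINT x|K. indicator H x * indicator S x))"
    if K: "finite_measure K" "sets K = sets borel" for K
  proof -
    have i: "integrable K (\<lambda>x. indicator H x * (indicator S x * (1 + cos (\<eta> \<bullet> x))))"
        "integrable K (\<lambda>x. indicator H x * (indicator S x * (1 + sin (\<eta> \<bullet> x))))"
        "integrable K (\<lambda>x. indicator H x * indicator S x :: real)"
      using bnd by (auto intro!: int[OF K, of _ 2] simp: indicator_def)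
    have "(CLINT x|K. indicator (S \<inter> H) x *\<^sub>R iexp (\<eta> \<bullet> x)) =
      (CLINT x|K. of_real (indicator H x * (indicator S x * (1 + cos (\<eta> \<bullet> x))) - indicator H x * indicator S x) +
      \<i> * of_real (indicator H x * (indicator S x * (1 + sin (\<eta> \<bullet> x))) - indicator H x * indicator S x))"
      by (intro Bochner_Integration.integral_cong) (auto simp: indicator_def exp_eq_polar complex_eq_iff)
    also have "\<dots> = of_real (LINT x|K. indicator H x * (indicator S x * (1 + cos (\<eta> \<bullet> x))) - indicator H x * indicator S x) +
      \<i> * of_real (LINT x|K. indicator H x * (indicator S x * (1 + sin (\<eta> \<bullet> x))) - indicator H x * indicator S x)"
      using i by (subst Bochner_Integration.integral_add)
        (auto simp del: of_real_diff of_real_mult of_real_add)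
    finally show ?thesis using i by simp
  qed
  thus ?thesis using fin sets one c s by (simp add: H_def)
qed

section \<open>Half-spaces as a generator of the Borel sets\<close>

text \<open>Closed balls are countable intersections of half-spaces, and open sets are countable
  unions of closed balls; both steps use a countable dense set \<open>D\<close>. Taking finite
  intersections of half-spaces makes the generator stable under intersection.\<close>

lemma halfspaces_generate_borel:
  "sets (borel :: 'a::{real_inner, second_countable_topology} measure) =
    sigma_sets UNIV {\<Inter>F | F. finite F \<and> F \<subseteq> (\<Union>\<xi>. range (\<lambda>a. {x. \<xi> \<bullet> x \<le> a}))}"
  (is "_ = sigma_sets UNIV ?E")
proof (rule antisym)
  let ?S = "sigma UNIV ?E"
  have half: "{x. \<xi> \<bullet> x \<le> a} \<in> sets ?S" for \<xi> :: 'a and a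
  proof -
    have "{x. \<xi> \<bullet> x \<le> a} \<in> ?E"
      by (intro CollectI exI[of _ "{{x. \<xi> \<bullet> x \<le> a}}"]) auto
    thus ?thesis by simp
  qed
  obtain D :: "'a set" where D: "countable D" "\<And>U. open U \<Longrightarrow> U \<noteq> {} \<Longrightarrow> \<exists>d\<in>D. d \<in> U"
    by (rule countable_dense_setE) blast
  have cball: "cball c r \<in> sets ?S" if r: "r \<ge> 0" for c :: 'a and r
  proof -
    \<comment> \<open>Dual description of the norm. The factor \<open>norm d\<close> makes the
      condition homogeneous in \<open>d\<close>, so the directions can range over a dense subset of
      the whole space instead of the unit sphere. The inclusion from left to right is
      Cauchy-Schwarz.\<close>
    have "cball c r = (\<Inter>d\<in>D. {x. d \<bullet> x \<le> r * norm d + d \<bullet> c})"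
    proof (intro set_eqI iffI INT_I CollectI)
      fix x d :: 'a assume "x \<in> cball c r"
      hence "norm (x - c) \<le> r" by (simp add: dist_norm norm_minus_commute)
      hence "norm d * norm (x - c) \<le> norm d * r" by (intro mult_left_mono) auto
      thus "d \<bullet> x \<le> r * norm d + d \<bullet> c"
        using norm_cauchy_schwarz[of d "x - c"] by (simp add: inner_diff_right algebra_simps)
    next
      fix x assume x: "x \<in> (\<Inter>d\<in>D. {x. d \<bullet> x \<le> r * norm d + d \<bullet> c})"
      show "x \<in> cball c r"
      proof (rule ccontr)
        assume "x \<notin> cball c r"
        hence lt: "r < norm (x - c)" by (simp add: dist_norm norm_minus_commute)
        \<comment> \<open>For \<open>x\<close> outside the ball the direction \<open>x - c\<close>
          violates its bound strictly. Violation is an open condition on \<open>d\<close>, hence it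
          also occurs for some \<open>d\<close> in \<open>D\<close>.\<close>
        have "open {d. r * norm d < d \<bullet> (x - c)}"
          by (intro open_Collect_less continuous_intros)
        moreover have "r * norm (x - c) < (x - c) \<bullet> (x - c)"
          using lt r by (auto simp: dot_square_norm power2_eq_square intro!: mult_strict_right_mono)
        ultimately obtain d where "d \<in> D" "r * norm d < d \<bullet> (x - c)"
          using D(2)[of "{d. r * norm d < d \<bullet> (x - c)}"] by blast
        thus False using x by (force simp: inner_diff_right)
      qed
    qed
    moreover have "(\<Inter>d\<in>D. {x. d \<bullet> x \<le> r * norm d + d \<bullet> c}) \<in> sets ?S" if "D \<noteq> {}"
      using D(1) that half by (intro sets.countable_INT') auto
    moreover have "D \<noteq> {}" using D(2)[of UNIV] by auto
    ultimately show ?thesis by simp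
  qed
  have "U \<in> sets ?S" if U: "open U" for U :: "'a set"
  proof -
    define J where "J = {(d, q) \<in> D \<times> \<rat>. 0 \<le> q \<and> cball d q \<subseteq> U}"
    have "U \<subseteq> (\<Union>(d, q)\<in>J. cball d q)"
    proof
      fix x assume "x \<in> U"
      then obtain e where e: "e > 0" "ball x e \<subseteq> U" using U by (meson open_contains_ball)
      \<comment> \<open>A ball of radius \<open>q\<close> whose centre lies within \<open>q\<close>
        of \<open>x\<close> stays within \<open>2 * q < e\<close> of \<open>x\<close>.\<close>
      obtain q where q: "q \<in> \<rat>" "0 < q" "q < e / 2" using Rats_dense_in_real[of 0 "e / 2"] e by auto
      obtain d where d: "d \<in> D" "d \<in> ball x q" using D(2)[of "ball x q"] q by auto
      have "cball d q \<subseteq> ball x e"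
      proof
        fix y assume "y \<in> cball d q"
        thus "y \<in> ball x e" using d q dist_triangle[of x y d] by auto
      qed
      hence "(d, q) \<in> J" using d q e by (auto simp: J_def)
      thus "x \<in> (\<Union>(d, q)\<in>J. cball d q)"
        using d by (intro UN_I[of "(d, q)"]) (auto simp: dist_commute)
    qed
    hence "U = (\<Union>(d, q)\<in>J. cball d q)" by (auto simp: J_def)
    moreover have "countable J"
      by (rule countable_subset[of _ "D \<times> \<rat>"]) (auto simp: J_def D countable_rat)
    moreover have "cball d q \<in> sets ?S" if "(d, q) \<in> J" for d q
      using that by (intro cball) (simp add: J_def)
    ultimately show ?thesis
      using sets.countable_UN''[of J "\<lambda>(d, q). cball d q" ?S] by auto
  qed
  hence "sigma_sets UNIV {U :: 'a set. open U} \<subseteq> sets ?S"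
    by (intro sets.sigma_sets_subset[of _ ?S, simplified space_measure_of_conv]) auto
  thus "sets borel \<subseteq> sigma_sets UNIV ?E"
    by (simp add: borel_def)
  show "sigma_sets UNIV ?E \<subseteq> sets (borel :: 'a measure)"
    by (intro sets.sigma_sets_subset[of _ borel, simplified])
       (auto intro!: borel_closed closed_Inter simp: closed_halfspace_le dest!: subsetD)
qed

text \<open>Half-spaces are intersected one at a time. The induction carries agreement at every
  frequency \<open>\<eta>\<close>, not just the equality of measures, because restricting to the
  next half-space needs the full characteristic function.\<close>

lemma characteristic_function_uniqueness:
  fixes M N :: "'a::{real_inner, second_countable_topology} measure"
  assumes fin: "finite_measure M" "finite_measure N"
    and sets: "sets M = sets borel" "sets N = sets borel"
    and char: "\<And>\<eta>. (CLINT x|M. iexp (\<eta> \<bullet> x)) = (CLINT x|N. iexp (\<eta> \<bullet> x))"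
  shows "M = N"
proof -
  let ?H = "\<Union>\<xi>. range (\<lambda>a. {x::'a. \<xi> \<bullet> x \<le> a})"
  interpret M: finite_measure M by fact
  interpret N: finite_measure N by fact
  have char_Inter: "\<Inter>F \<in> sets borel \<and>
      (\<forall>\<eta>. (CLINT x|M. indicator (\<Inter>F) x *\<^sub>R iexp (\<eta> \<bullet> x)) = (CLINT x|N. indicator (\<Inter>F) x *\<^sub>R iexp (\<eta> \<bullet> x)))"
    if "finite F" "F \<subseteq> ?H" for F
    using that
  proof (induction F)
    case empty
    show ?case using char by simp
  next
    case (insert S F)
    then obtain \<xi> a where S: "S = {x. \<xi> \<bullet> x \<le> a}" by auto
    have F: "\<Inter>F \<in> sets borel"
      "\<And>\<eta>. (CLINT x|M. indicator (\<Inter>F) x *\<^sub>R iexp (\<eta> \<bullet> x)) = (CLINT x|N. indicator (\<Inter>F) x *\<^sub>R iexp (\<eta> \<bullet> x))"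
      using insert by auto
    have "\<Inter>(insert S F) = \<Inter>F \<inter> {x. \<xi> \<bullet> x \<le> a}" by (auto simp: S)
    moreover have "{x. \<xi> \<bullet> x \<le> a} \<in> sets borel" by measurable
    ultimately show ?case
      using char_eq_Int_halfspace[OF fin sets F] F(1) by simp
  qed
  show ?thesis
  proof (rule measure_eqI_generator_eq[where \<Omega> = UNIV and A = "\<lambda>_. UNIV"
        and E = "{\<Inter>F | F. finite F \<and> F \<subseteq> ?H}"])
    show "Int_stable {\<Inter>F | F. finite F \<and> F \<subseteq> ?H}"
    proof (rule Int_stableI, clarify)
      fix F G assume "finite F" "F \<subseteq> ?H" "finite G" "G \<subseteq> ?H"
      thus "\<exists>K. \<Inter>F \<inter> \<Inter>G = \<Inter>K \<and> finite K \<and> K \<subseteq> ?H"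
        by (intro exI[of _ "F \<union> G"]) auto
    qed
    fix X assume "X \<in> {\<Inter>F | F. finite F \<and> F \<subseteq> ?H}"
    then obtain F where F: "X = \<Inter>F" "finite F" "F \<subseteq> ?H" by blast
    \<comment> \<open>At frequency 0 the characteristic function restricted to \<open>X\<close> is
      the measure of \<open>X\<close>.\<close>
    have "complex_of_real (measure M X) = complex_of_real (measure N X)"
      using char_Inter[OF F(2,3)] sets F(1) by (auto dest!: spec[of _ 0] simp: scaleR_conv_of_real)
    thus "emeasure M X = emeasure N X"
      by (simp add: M.emeasure_eq_measure N.emeasure_eq_measure)
  qed (use sets halfspaces_generate_borel in \<open>auto intro!: exI[of _ "{}"]\<close>)
qed

section \<open>The pCN kernel\<close>

locale gaussian_reference =
  fixes C :: "'a::{real_inner, polish_space} \<Rightarrow> 'a" and \<mu>\<^sub>0 :: "'a measure" and \<rho> :: real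
  assumes C_linear: "linear C"
    and gauss: "centered_gaussian C \<mu>\<^sub>0"
    and rho: "\<rho> \<in> {0..1}"
begin

abbreviation "\<sigma> \<equiv> sqrt (1 - \<rho>\<^sup>2)"

abbreviation "Q \<equiv> pcn_proposal \<mu>\<^sub>0 \<rho>"

lemma sets_ref[measurable_cong, simp]: "sets \<mu>\<^sub>0 = sets borel"
  using gauss by (simp add: centered_gaussian_def)

lemma space_ref[simp]: "space \<mu>\<^sub>0 = UNIV"
  using sets_eq_imp_space_eq[OF sets_ref] by simp

sublocale ref: prob_space \<mu>\<^sub>0
  using gauss by (simp add: centered_gaussian_def)

lemma sigma_sq: "\<sigma>\<^sup>2 = 1 - \<rho>\<^sup>2"
  using rho by (simp add: power_le_one)

lemma ref_in_prob_algebra: "\<mu>\<^sub>0 \<in> space (prob_algebra borel)"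
  by (simp add: space_prob_algebra ref.prob_space_axioms)

section \<open>Rotation invariance of the Gaussian product measure\<close>

text \<open>The pair \<open>(a, b)\<close> plays the role of the adjoint of \<open>f\<close> applied
  to \<open>\<eta>\<close>. By Fubini the integral then factors into two Gaussian characteristic
  functions.\<close>

lemma char_pair:
  fixes f :: "'a \<times> 'a \<Rightarrow> 'a \<times> 'a"
  assumes f[measurable]: "f \<in> borel \<Otimes>\<^sub>M borel \<rightarrow>\<^sub>M borel \<Otimes>\<^sub>M borel"
    and split: "\<And>q w. \<eta> \<bullet> f (q, w) = a \<bullet> q + b \<bullet> w"
  shows "(CLINT x|distr (\<mu>\<^sub>0 \<Otimes>\<^sub>M \<mu>\<^sub>0) (borel \<Otimes>\<^sub>M borel) f. iexp (\<eta> \<bullet> x)) =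
    exp (complex_of_real (- (1/2) * (C a \<bullet> a + C b \<bullet> b)))"
proof -
  interpret P: pair_prob_space \<mu>\<^sub>0 \<mu>\<^sub>0 ..
  have [measurable]: "(\<lambda>x. iexp (\<eta> \<bullet> x)) \<in> borel_measurable (borel \<Otimes>\<^sub>M borel)"
    unfolding borel_prod by measurable
  have "(CLINT x|distr (\<mu>\<^sub>0 \<Otimes>\<^sub>M \<mu>\<^sub>0) (borel \<Otimes>\<^sub>M borel) f. iexp (\<eta> \<bullet> x)) =
      (CLINT x|\<mu>\<^sub>0 \<Otimes>\<^sub>M \<mu>\<^sub>0. iexp (\<eta> \<bullet> f x))"
    by (subst integral_distr) auto
  also have "\<dots> = (CLINT (q, w)|\<mu>\<^sub>0 \<Otimes>\<^sub>M \<mu>\<^sub>0. iexp (a \<bullet> q) * iexp (b \<bullet> w))"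
    by (intro Bochner_Integration.integral_cong) (auto simp: split exp_add[symmetric] algebra_simps)
  also have "\<dots> = (CLINT q|\<mu>\<^sub>0. CLINT w|\<mu>\<^sub>0. iexp (a \<bullet> q) * iexp (b \<bullet> w))"
    by (subst P.integral_fst'[symmetric])
       (auto intro!: P.P.integrable_const_bound[of _ 1] simp: norm_mult case_prod_unfold)
  also have "\<dots> = (CLINT q|\<mu>\<^sub>0. iexp (a \<bullet> q)) * (CLINT w|\<mu>\<^sub>0. iexp (b \<bullet> w))"
    by simp
  also have "\<dots> = exp (complex_of_real (- (1/2) * (C a \<bullet> a + C b \<bullet> b)))"
    using gauss by (simp add: centered_gaussian_def exp_add[symmetric] algebra_simps add_divide_distrib)
  finally show ?thesis .
qed

text \<open>The reflection is self-adjoint, so its effect on characteristic functions is to apply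
  the same reflection to the frequency pair. It remains to see that the quadratic form of the
  product covariance is unchanged.\<close>

lemma distr_reflection:
  "distr (\<mu>\<^sub>0 \<Otimes>\<^sub>M \<mu>\<^sub>0) (borel \<Otimes>\<^sub>M borel) (\<lambda>(q, w). (\<rho> *\<^sub>R q + \<sigma> *\<^sub>R w, \<sigma> *\<^sub>R q - \<rho> *\<^sub>R w)) =
    \<mu>\<^sub>0 \<Otimes>\<^sub>M \<mu>\<^sub>0" (is "distr ?P _ ?R = _")
proof -
  interpret P: pair_prob_space \<mu>\<^sub>0 \<mu>\<^sub>0 ..
  have R: "?R \<in> borel \<Otimes>\<^sub>M borel \<rightarrow>\<^sub>M borel \<Otimes>\<^sub>M borel" by measurable
  have sets_P: "sets ?P = sets (borel \<Otimes>\<^sub>M borel)" by (intro sets_pair_measure_cong) auto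
  have R_P: "?R \<in> ?P \<rightarrow>\<^sub>M borel \<Otimes>\<^sub>M borel" by measurable
  \<comment> \<open>The right-hand side is written as an image under the identity so that
    \<open>char_pair\<close> computes both characteristic functions.\<close>
  have "distr ?P (borel \<Otimes>\<^sub>M borel) ?R = distr ?P (borel \<Otimes>\<^sub>M borel) (\<lambda>x. x)"
  proof (rule characteristic_function_uniqueness)
    show "finite_measure (distr ?P (borel \<Otimes>\<^sub>M borel) ?R)"
      using R_P by (rule P.P.finite_measure_distr)
    show "finite_measure (distr ?P (borel \<Otimes>\<^sub>M borel) (\<lambda>x. x))"
      by (rule P.P.finite_measure_distr) (simp add: measurable_ident_sets[OF sets_P])
    fix \<zeta> :: "'a \<times> 'a"
    obtain \<xi> \<eta> where \<zeta>: "\<zeta> = (\<xi>, \<eta>)" by (cases \<zeta>)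
    \<comment> \<open>The cross terms of the two quadratic forms have opposite signs and cancel; the
      remaining factor \<open>\<rho>\<^sup>2 + \<sigma>\<^sup>2\<close> is 1.\<close>
    have "C (\<rho> *\<^sub>R \<xi> + \<sigma> *\<^sub>R \<eta>) \<bullet> (\<rho> *\<^sub>R \<xi> + \<sigma> *\<^sub>R \<eta>) + C (\<sigma> *\<^sub>R \<xi> - \<rho> *\<^sub>R \<eta>) \<bullet> (\<sigma> *\<^sub>R \<xi> - \<rho> *\<^sub>R \<eta>) =
        (\<rho>\<^sup>2 + \<sigma>\<^sup>2) * (C \<xi> \<bullet> \<xi> + C \<eta> \<bullet> \<eta>)"
      by (simp add: linear_add[OF C_linear] linear_diff[OF C_linear] linear_scale[OF C_linear]
          inner_add_left inner_add_right inner_diff_left inner_diff_right power2_eq_square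
          algebra_simps del: real_sqrt_mult_self)
    hence eq: "C (\<rho> *\<^sub>R \<xi> + \<sigma> *\<^sub>R \<eta>) \<bullet> (\<rho> *\<^sub>R \<xi> + \<sigma> *\<^sub>R \<eta>) + C (\<sigma> *\<^sub>R \<xi> - \<rho> *\<^sub>R \<eta>) \<bullet> (\<sigma> *\<^sub>R \<xi> - \<rho> *\<^sub>R \<eta>) =
        C \<xi> \<bullet> \<xi> + C \<eta> \<bullet> \<eta>" unfolding sigma_sq by simp
    have "(CLINT x|distr ?P (borel \<Otimes>\<^sub>M borel) ?R. iexp (\<zeta> \<bullet> x)) =
        exp (complex_of_real (- (1/2) * (C \<xi> \<bullet> \<xi> + C \<eta> \<bullet> \<eta>)))"
      unfolding eq[symmetric]
      by (rule char_pair[OF R])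
         (simp add: \<zeta> inner_add_left inner_add_right inner_diff_left inner_diff_right)
    moreover have "(CLINT x|distr ?P (borel \<Otimes>\<^sub>M borel) (\<lambda>x. x). iexp (\<zeta> \<bullet> x)) =
        exp (complex_of_real (- (1/2) * (C \<xi> \<bullet> \<xi> + C \<eta> \<bullet> \<eta>)))"
      by (rule char_pair) (simp_all add: \<zeta>)
    ultimately show "(CLINT x|distr ?P (borel \<Otimes>\<^sub>M borel) ?R. iexp (\<zeta> \<bullet> x)) =
        (CLINT x|distr ?P (borel \<Otimes>\<^sub>M borel) (\<lambda>x. x). iexp (\<zeta> \<bullet> x))" by simp
  qed (simp_all add: borel_prod)
  also have "\<dots> = ?P" using sets_P by (intro distr_id2) simp
  finally show ?thesis .
qed

section \<open>Reversibility of the single-proposal kernel\<close>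

lemma sets_pcn[measurable_cong, simp]: "sets (Q q) = sets borel"
  by (simp add: pcn_proposal_def)

lemma prob_space_pcn: "prob_space (Q q)"
  unfolding pcn_proposal_def by (rule ref.prob_space_distr) measurable

lemma pcn_measurable[measurable]: "Q \<in> borel \<rightarrow>\<^sub>M prob_algebra borel"
  unfolding pcn_proposal_def
  by (rule measurable_distr_prob_space2[where M = borel]) (use ref_in_prob_algebra in measurable)

text \<open>For \<open>x\<close> distributed as
  \<open>\<mu>\<^sub>0 \<Otimes>\<^sub>M \<mu>\<^sub>0\<close>, the pair of \<open>fst x\<close> and
  \<open>fst (R x)\<close> is a start point and its proposal. Since \<open>R\<close> preserves the
  product measure and undoes itself, replacing \<open>x\<close> by \<open>R x\<close> exchanges the
  two. The form with a general integrand \<open>g\<close> allows an inner integral over the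
  remaining proposals later.\<close>

lemma pcn_reversible:
  assumes g[measurable]: "(\<lambda>(x, y). g x y) \<in> borel_measurable (borel \<Otimes>\<^sub>M borel)"
  shows "(\<integral>\<^sup>+q. \<integral>\<^sup>+q'. g q q' \<partial>Q q \<partial>\<mu>\<^sub>0) = (\<integral>\<^sup>+q. \<integral>\<^sup>+q'. g q' q \<partial>Q q \<partial>\<mu>\<^sub>0)"
proof -
  interpret P: pair_prob_space \<mu>\<^sub>0 \<mu>\<^sub>0 ..
  define R where "R = (\<lambda>(q :: 'a, w). (\<rho> *\<^sub>R q + \<sigma> *\<^sub>R w, \<sigma> *\<^sub>R q - \<rho> *\<^sub>R w))"
  have R[measurable]: "R \<in> borel \<Otimes>\<^sub>M borel \<rightarrow>\<^sub>M borel \<Otimes>\<^sub>M borel" unfolding R_def by measurable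
  have Q: "(\<integral>\<^sup>+q. \<integral>\<^sup>+q'. h q q' \<partial>Q q \<partial>\<mu>\<^sub>0) = (\<integral>\<^sup>+x. h (fst x) (fst (R x)) \<partial>(\<mu>\<^sub>0 \<Otimes>\<^sub>M \<mu>\<^sub>0))"
    if h[measurable]: "(\<lambda>(x, y). h x y) \<in> borel_measurable (borel \<Otimes>\<^sub>M borel)" for h :: "'a \<Rightarrow> 'a \<Rightarrow> ennreal"
  proof -
    have "(\<integral>\<^sup>+q. \<integral>\<^sup>+q'. h q q' \<partial>Q q \<partial>\<mu>\<^sub>0) = (\<integral>\<^sup>+q. \<integral>\<^sup>+w. h q (\<rho> *\<^sub>R q + \<sigma> *\<^sub>R w) \<partial>\<mu>\<^sub>0 \<partial>\<mu>\<^sub>0)"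
      unfolding pcn_proposal_def by (intro nn_integral_cong nn_integral_distr) measurable
    also have "\<dots> = (\<integral>\<^sup>+(q, w). h q (\<rho> *\<^sub>R q + \<sigma> *\<^sub>R w) \<partial>(\<mu>\<^sub>0 \<Otimes>\<^sub>M \<mu>\<^sub>0))"
      by (subst ref.nn_integral_fst[symmetric]) auto
    finally show ?thesis by (simp add: R_def case_prod_unfold)
  qed
  have RR: "fst (R (R x)) = fst x" for x
  proof -
    obtain q w where x: "x = (q, w)" by (cases x)
    have "fst (R (R x)) = (\<rho>\<^sup>2 + \<sigma>\<^sup>2) *\<^sub>R q"
      by (simp add: x R_def algebra_simps power2_eq_square del: real_sqrt_mult_self)
    thus ?thesis unfolding sigma_sq by (simp add: x)
  qed
  have "(\<integral>\<^sup>+q. \<integral>\<^sup>+q'. g q q' \<partial>Q q \<partial>\<mu>\<^sub>0) = (\<integral>\<^sup>+x. g (fst x) (fst (R x)) \<partial>(\<mu>\<^sub>0 \<Otimes>\<^sub>M \<mu>\<^sub>0))"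
    by (rule Q) fact
  also have "\<dots> = (\<integral>\<^sup>+x. g (fst x) (fst (R x)) \<partial>distr (\<mu>\<^sub>0 \<Otimes>\<^sub>M \<mu>\<^sub>0) (borel \<Otimes>\<^sub>M borel) R)"
    unfolding R_def distr_reflection ..
  also have "\<dots> = (\<integral>\<^sup>+x. g (fst (R x)) (fst x) \<partial>(\<mu>\<^sub>0 \<Otimes>\<^sub>M \<mu>\<^sub>0))"
    by (subst nn_integral_distr) (auto simp: RR)
  also have "\<dots> = (\<integral>\<^sup>+q. \<integral>\<^sup>+q'. g q' q \<partial>Q q \<partial>\<mu>\<^sub>0)"
    by (rule Q[symmetric]) measurable
  finally show ?thesis .
qed

end

section \<open>The multiproposal pCN kernel\<close>

locale mpcn = gaussian_reference C \<mu>\<^sub>0 \<rho>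
  for C :: "'a::{real_inner, polish_space} \<Rightarrow> 'a" and \<mu>\<^sub>0 \<rho> +
  fixes \<Phi> :: "'a \<Rightarrow> real" and p :: nat
  assumes Phi[measurable]: "\<Phi> \<in> borel_measurable borel"
    and exp_integrable: "integrable \<mu>\<^sub>0 (\<lambda>q. exp (- \<Phi> q))"
begin

abbreviation "PX \<equiv> (\<Pi>\<^sub>M k\<in>{1..p}. borel :: 'a measure)"

abbreviation "T q \<equiv> (\<Pi>\<^sub>M k\<in>{1..p}. Q q)"

abbreviation "V \<equiv> mpcn_proposal \<mu>\<^sub>0 \<rho> p"

abbreviation "P \<equiv> mpcn_kernel \<mu>\<^sub>0 \<Phi> \<rho> p"

abbreviation "\<mu> \<equiv> target_measure \<mu>\<^sub>0 \<Phi>"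

section \<open>Acceptance weights on full tuples\<close>

text \<open>The weights take the whole tuple with indices \<open>0..p\<close>, start point included,
  so that permutations of all coordinates can act on the argument.\<close>

definition accept :: "nat \<Rightarrow> (nat \<Rightarrow> 'a) \<Rightarrow> real" where
  "accept j u = exp (- \<Phi> (u j)) / (\<Sum>k=0..p. exp (- \<Phi> (u k)))"

lemma mpcn_accept_eq: "mpcn_accept \<Phi> p j q v = accept j (v(0 := q))"
  unfolding mpcn_accept_def accept_def ..

lemma accept_measurable[measurable]:
  "j \<in> {0..p} \<Longrightarrow> accept j \<in> borel_measurable (\<Pi>\<^sub>M k\<in>{0..p}. borel)"
  unfolding accept_def by measurable

lemma accept_nonneg: "0 \<le> accept j u"
  unfolding accept_def by (intro divide_nonneg_nonneg sum_nonneg) auto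

lemma sum_accept: "(\<Sum>j=0..p. accept j u) = 1"
proof -
  have "(\<Sum>k=0..p. exp (- \<Phi> (u k))) > 0" by (intro sum_pos) auto
  thus ?thesis unfolding accept_def sum_divide_distrib[symmetric] by simp
qed

lemma fun_upd_measurable[measurable]:
  "(\<lambda>(q, v). v(0 := q)) \<in> borel \<Otimes>\<^sub>M PX \<rightarrow>\<^sub>M (\<Pi>\<^sub>M k\<in>{0..p}. borel)"
  unfolding case_prod_unfold
  by (rule measurable_fun_upd[where J = "{1..p}"]) (auto simp: measurable_fst measurable_snd)

lemma fun_upd_measurable'[measurable]: "(\<lambda>v. v(0 := q)) \<in> PX \<rightarrow>\<^sub>M (\<Pi>\<^sub>M k\<in>{0..p}. borel)"
  by (rule measurable_fun_upd[where J = "{1..p}"]) auto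

section \<open>The proposal and the transition as Markov kernels\<close>

text \<open>The product of proposals is the image of the fixed measure \<open>?W\<close> under a map
  jointly measurable in \<open>q\<close> and the noise, so measurability in \<open>q\<close> follows
  from that of the map.\<close>

lemma product_pcn_measurable[measurable]: "(\<lambda>q. T q) \<in> borel \<rightarrow>\<^sub>M prob_algebra PX"
proof -
  let ?W = "\<Pi>\<^sub>M k\<in>{1..p}. \<mu>\<^sub>0"
  have W: "prob_space ?W" by (intro prob_space_PiM ref.prob_space_axioms)
  have sets_W: "sets ?W = sets PX" by (intro sets_PiM_cong) auto
  have T_distr: "T q = distr ?W PX (\<lambda>v. \<lambda>k\<in>{1..p}. \<rho> *\<^sub>R q + \<sigma> *\<^sub>R v k)" for q
  proof -
    \<comment> \<open>Here \<open>Q q\<close> as the target of \<open>distr\<close> only provides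
      the Borel sigma-algebra.\<close>
    have "distr ?W (Pi\<^sub>M {1..p} (\<lambda>_. Q q)) (compose {1..p} (\<lambda>w. \<rho> *\<^sub>R q + \<sigma> *\<^sub>R w)) =
        (\<Pi>\<^sub>M k\<in>{1..p}. distr \<mu>\<^sub>0 (Q q) (\<lambda>w. \<rho> *\<^sub>R q + \<sigma> *\<^sub>R w))"
      using ref.prob_space_axioms prob_space_pcn
      by (intro distr_PiM_finite_prob_space') (auto, measurable)
    also have "distr \<mu>\<^sub>0 (Q q) (\<lambda>w. \<rho> *\<^sub>R q + \<sigma> *\<^sub>R w) = Q q"
      unfolding pcn_proposal_def by (intro distr_cong) auto
    finally have "T q = distr ?W (Pi\<^sub>M {1..p} (\<lambda>_. Q q)) (compose {1..p} (\<lambda>w. \<rho> *\<^sub>R q + \<sigma> *\<^sub>R w))" ..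
    also have "\<dots> = distr ?W PX (\<lambda>v. \<lambda>k\<in>{1..p}. \<rho> *\<^sub>R q + \<sigma> *\<^sub>R v k)"
      by (intro distr_cong sets_PiM_cong) (auto simp: compose_def)
    finally show ?thesis .
  qed
  have W_in: "?W \<in> space (prob_algebra PX)"
    using W sets_W by (simp add: space_prob_algebra)
  have "(\<lambda>q. distr ?W PX (\<lambda>v. \<lambda>k\<in>{1..p}. \<rho> *\<^sub>R q + \<sigma> *\<^sub>R v k)) \<in> borel \<rightarrow>\<^sub>M prob_algebra PX"
  proof (rule measurable_distr_prob_space2)
    show "(\<lambda>q :: 'a. ?W) \<in> borel \<rightarrow>\<^sub>M prob_algebra PX" using W_in by measurable
    show "(\<lambda>(q, v). \<lambda>k\<in>{1..p}. \<rho> *\<^sub>R q + \<sigma> *\<^sub>R v k) \<in> borel \<Otimes>\<^sub>M PX \<rightarrow>\<^sub>M PX"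
      unfolding case_prod_unfold by (intro measurable_restrict) measurable
  qed
  thus ?thesis unfolding T_distr .
qed

lemma mpcn_proposal_measurable[measurable]: "V \<in> borel \<rightarrow>\<^sub>M prob_algebra PX"
  unfolding mpcn_proposal_def
  by (rule measurable_bind_prob_space[OF pcn_measurable product_pcn_measurable])

lemma sets_mpcn_proposal[measurable_cong, simp]: "sets (V q) = sets PX"
  using measurable_space[OF mpcn_proposal_measurable, of q] by (simp add: space_prob_algebra)

lemma prob_space_mpcn_proposal: "prob_space (V q)"
  using measurable_space[OF mpcn_proposal_measurable, of q] by (simp add: space_prob_algebra)

lemma sets_mpcn_kernel[measurable_cong, simp]: "sets (P q) = sets borel"
  unfolding mpcn_kernel_def using sets.sigma_sets_eq[of "borel :: 'a measure"] by (simp add: sets_measure_of_conv)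

text \<open>\<open>measure_of\<close> returns the prescribed set function only once that function is
  known to be countably additive; this comes from exchanging series and integral for nonnegative
  terms. Dirac masses become indicators.\<close>

lemma emeasure_mpcn_kernel:
  assumes B: "B \<in> sets borel"
  shows "emeasure (P q) B =
    (\<Sum>j=0..p. \<integral>\<^sup>+v. ennreal (accept j (v(0 := q))) * indicator B ((v(0 := q)) j) \<partial>V q)"
proof -
  let ?f = "\<lambda>A. \<Sum>j=0..p. \<integral>\<^sup>+v. ennreal (mpcn_accept \<Phi> p j q v) *
                emeasure (return borel ((v(0 := q)) j)) A \<partial>V q"
  have meas: "(\<lambda>v. ennreal (accept j (v(0 := q))) * indicator A ((v(0 := q)) j)) \<in> borel_measurable (V q)"
    if [measurable]: "A \<in> sets borel" "j \<in> {0..p}" for A j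
    by measurable
  have "emeasure (measure_of UNIV (sets borel) ?f) B = ?f B"
  proof (rule emeasure_measure_of_sigma)
    show "sigma_algebra UNIV (sets (borel :: 'a measure))"
      using sets.sigma_algebra_axioms[of "borel :: 'a measure"] by simp
    show "positive (sets borel) ?f" by (simp add: positive_def)
    show "countably_additive (sets borel) ?f"
    proof (rule countably_additiveI)
      fix A :: "nat \<Rightarrow> 'a set"
      assume A: "range A \<subseteq> sets borel" "disjoint_family A" "(\<Union>i. A i) \<in> sets borel"
      have "(\<Sum>i. ?f (A i)) = (\<Sum>j=0..p. \<Sum>i. \<integral>\<^sup>+v. ennreal (mpcn_accept \<Phi> p j q v) *
                emeasure (return borel ((v(0 := q)) j)) (A i) \<partial>V q)"
        by (rule suminf_sum) simp
      also have "\<dots> = (\<Sum>j=0..p. \<integral>\<^sup>+v. (\<Sum>i. ennreal (mpcn_accept \<Phi> p j q v) *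
                emeasure (return borel ((v(0 := q)) j)) (A i)) \<partial>V q)"
        using A meas by (intro sum.cong refl nn_integral_suminf[symmetric]) (auto simp: mpcn_accept_eq)
      also have "\<dots> = ?f (\<Union>i. A i)"
        using A by (simp add: suminf_emeasure del: emeasure_return)
      finally show "(\<Sum>i. ?f (A i)) = ?f (\<Union>i. A i)" .
    qed
  qed fact
  thus ?thesis unfolding mpcn_kernel_def using B by (simp add: mpcn_accept_eq)
qed

text \<open>The total mass is 1 because the acceptance weights of each tuple sum to 1. Measurability
  in \<open>q\<close> is inherited from the kernel \<open>V\<close>, whose integrand also depends on
  \<open>q\<close>.\<close>

lemma mpcn_kernel_measurable[measurable]: "P \<in> borel \<rightarrow>\<^sub>M prob_algebra borel"
proof (intro measurable_prob_algebraI measurable_subprob_algebra)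
  fix q :: 'a
  have space: "space (P q) = UNIV" using sets_eq_imp_space_eq[OF sets_mpcn_kernel] by simp
  interpret V: prob_space "V q" by (rule prob_space_mpcn_proposal)
  have "emeasure (P q) UNIV = (\<integral>\<^sup>+v. (\<Sum>j=0..p. ennreal (accept j (v(0 := q)))) \<partial>V q)"
    by (subst emeasure_mpcn_kernel) (auto intro!: nn_integral_sum[symmetric])
  also have "\<dots> = (\<integral>\<^sup>+v. 1 \<partial>V q)"
    by (simp add: sum_ennreal accept_nonneg sum_accept)
  finally show "prob_space (P q)"
    by (intro prob_spaceI) (simp add: space V.emeasure_space_1)
  thus "subprob_space (P q)" by (rule prob_space_imp_subprob_space)
next
  fix B :: "'a set" assume B[measurable]: "B \<in> sets borel"
  show "(\<lambda>q. emeasure (P q) B) \<in> borel_measurable borel"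
    unfolding emeasure_mpcn_kernel[OF B]
  proof (intro borel_measurable_sum nn_integral_measurable_subprob_algebra2)
    fix j assume [measurable]: "j \<in> {0..p}"
    have [measurable]: "(\<lambda>x. (snd x)(0 := fst x)) \<in> borel \<Otimes>\<^sub>M PX \<rightarrow>\<^sub>M (\<Pi>\<^sub>M k\<in>{0..p}. borel)"
      using fun_upd_measurable by (simp add: case_prod_unfold)
    show "(\<lambda>(q, v). ennreal (accept j (v(0 := q))) * indicator B ((v(0 := q)) j))
        \<in> borel_measurable (borel \<Otimes>\<^sub>M PX)"
      unfolding case_prod_unfold by measurable
    show "V \<in> borel \<rightarrow>\<^sub>M subprob_algebra PX"
      by (rule measurable_prob_algebraD[OF mpcn_proposal_measurable])
  qed
qed simp

lemma prob_space_mpcn_kernel: "prob_space (P q)"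
  using measurable_space[OF mpcn_kernel_measurable, of q] by (simp add: space_prob_algebra)

lemma emeasure_mpcn_kernel_UNIV: "emeasure (P q) UNIV = 1"
  using prob_space.emeasure_space_1[OF prob_space_mpcn_kernel, of q] sets_eq_imp_space_eq[OF sets_mpcn_kernel]
  by simp

section \<open>Probability flow between two sets\<close>

definition dens :: "'a \<Rightarrow> real" where
  "dens q = 1 / (LINT q|\<mu>\<^sub>0. exp (- \<Phi> q)) * exp (- \<Phi> q)"

lemma dens_measurable[measurable]: "dens \<in> borel_measurable borel"
  unfolding dens_def by measurable

lemma dens_nonneg: "0 \<le> dens q"
  unfolding dens_def by (intro mult_nonneg_nonneg divide_nonneg_nonneg integral_nonneg) auto

lemma target_eq: "\<mu> = density \<mu>\<^sub>0 (\<lambda>q. ennreal (dens q))"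
  by (simp add: target_measure_def dens_def Let_def)

lemma sets_target[measurable_cong, simp]: "sets \<mu> = sets borel"
  by (simp add: target_eq)

lemma space_target[simp]: "space \<mu> = UNIV"
  by (simp add: target_eq)

lemma finite_target: "finite_measure \<mu>"
proof (rule finite_measureI)
  have "(\<integral>\<^sup>+q. ennreal (dens q) \<partial>\<mu>\<^sub>0) = ennreal (LINT q|\<mu>\<^sub>0. dens q)"
    using exp_integrable dens_nonneg by (intro nn_integral_eq_integral) (auto simp: dens_def)
  thus "emeasure \<mu> (space \<mu>) \<noteq> \<infinity>"
    by (simp add: target_eq emeasure_density)
qed

text \<open>The contribution of a tuple \<open>u\<close> to the flow from \<open>A\<close> to
  \<open>B\<close> when index \<open>j\<close> is selected, as a density relative to the law of the
  tuple started from \<open>\<mu>\<^sub>0\<close>.\<close>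

definition path_weight :: "'a set \<Rightarrow> 'a set \<Rightarrow> nat \<Rightarrow> (nat \<Rightarrow> 'a) \<Rightarrow> ennreal" where
  "path_weight A B j u =
    ennreal (dens (u 0) * accept j u) * (indicator A (u 0) * indicator B (u j))"

lemma path_weight_measurable[measurable]:
  assumes [measurable]: "A \<in> sets borel" "B \<in> sets borel" "j \<in> {0..p}"
  shows "path_weight A B j \<in> borel_measurable (\<Pi>\<^sub>M k\<in>{0..p}. borel)"
  unfolding path_weight_def by measurable

text \<open>The denominator of \<open>accept\<close> is symmetric in all coordinates, and the
  product of \<open>dens (u 0)\<close> with the numerator is a constant times
  \<open>exp (- \<Phi> (u 0)) * exp (- \<Phi> (u j))\<close>, symmetric in the two exchanged
  points.\<close>

lemma path_weight_swap:
  assumes j: "j \<in> {0..p}"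
  shows "path_weight A B j (\<lambda>n\<in>{0..p}. u (Transposition.transpose 0 j n)) = path_weight B A j u"
proof -
  \<comment> \<open>This is the denominator after \<open>restrict\<close> is unfolded; the
    \<open>undefined\<close> branch is never reached, as \<open>k\<close> runs up to
    \<open>p\<close>.\<close>
  have "(\<Sum>k=0..p. exp (- \<Phi> (if k \<le> p then u (Transposition.transpose 0 j k) else undefined))) =
      (\<Sum>k=0..p. exp (- \<Phi> (u (Transposition.transpose 0 j k))))"
    by (intro sum.cong) auto
  also have "\<dots> = (\<Sum>k=0..p. exp (- \<Phi> (u k)))"
    using j by (intro sum.reindex_bij_betw bij_betw_transpose_iff) auto
  finally have "accept j (\<lambda>n\<in>{0..p}. u (Transposition.transpose 0 j n)) = exp (- \<Phi> (u 0)) / (\<Sum>k=0..p. exp (- \<Phi> (u k)))"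
    using j by (simp add: accept_def restrict_def)
  moreover have "dens (u j) * (exp (- \<Phi> (u 0)) / (\<Sum>k=0..p. exp (- \<Phi> (u k)))) = dens (u 0) * accept j u"
    by (simp add: dens_def accept_def)
  ultimately show ?thesis
    using j by (simp add: path_weight_def mult.commute)
qed

text \<open>Reversibility lets the pivot be drawn first, from \<open>\<mu>\<^sub>0\<close>. Given
  the pivot, the start point is then one more draw from \<open>Q q\<close>, so all
  \<open>p + 1\<close> coordinates have a product law with equal factors.\<close>

lemma flow_eq:
  assumes A[measurable]: "A \<in> sets borel" and B[measurable]: "B \<in> sets borel"
  shows "(\<integral>\<^sup>+q. indicator A q * emeasure (P q) B \<partial>\<mu>) =
    (\<Sum>j=0..p. \<integral>\<^sup>+q. \<integral>\<^sup>+u. path_weight A B j u \<partial>(\<Pi>\<^sub>M k\<in>{0..p}. Q q) \<partial>\<mu>\<^sub>0)"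
proof -
  have [measurable]: "(\<lambda>x. (snd x)(0 := fst x)) \<in> borel \<Otimes>\<^sub>M PX \<rightarrow>\<^sub>M (\<Pi>\<^sub>M k\<in>{0..p}. borel)"
    using fun_upd_measurable by (simp add: case_prod_unfold)
  note subprob = measurable_prob_algebraD[OF product_pcn_measurable]
  have [measurable]: "(\<lambda>q. emeasure (P q) B) \<in> borel_measurable borel"
    using measurable_prob_algebraD[OF mpcn_kernel_measurable] B by measurable
  have step: "(\<integral>\<^sup>+q. \<integral>\<^sup>+v. path_weight A B j (v(0 := q)) \<partial>V q \<partial>\<mu>\<^sub>0) =
      (\<integral>\<^sup>+q. \<integral>\<^sup>+u. path_weight A B j u \<partial>(\<Pi>\<^sub>M k\<in>{0..p}. Q q) \<partial>\<mu>\<^sub>0)"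
    if j[measurable]: "j \<in> {0..p}" for j
  proof -
    have "(\<integral>\<^sup>+q. \<integral>\<^sup>+v. path_weight A B j (v(0 := q)) \<partial>V q \<partial>\<mu>\<^sub>0) =
        (\<integral>\<^sup>+q. \<integral>\<^sup>+q'. \<integral>\<^sup>+v. path_weight A B j (v(0 := q)) \<partial>T q' \<partial>Q q \<partial>\<mu>\<^sub>0)"
      unfolding mpcn_proposal_def
    proof (intro nn_integral_cong nn_integral_bind[where B = PX])
      show "(\<lambda>v. path_weight A B j (v(0 := q))) \<in> borel_measurable PX" for q by measurable
      show "T \<in> Q q \<rightarrow>\<^sub>M subprob_algebra PX" for q
        using subprob by (simp only: measurable_cong_sets[OF sets_pcn refl])
    qed
    \<comment> \<open>Start point and pivot exchange roles: from here on the outer variable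
      \<open>q\<close> is the pivot and \<open>q'\<close> is the start point.\<close>
    also have "\<dots> = (\<integral>\<^sup>+q. \<integral>\<^sup>+q'. \<integral>\<^sup>+v. path_weight A B j (v(0 := q')) \<partial>T q \<partial>Q q \<partial>\<mu>\<^sub>0)"
    proof (rule pcn_reversible)
      have "(\<lambda>x. \<integral>\<^sup>+v. path_weight A B j (v(0 := fst x)) \<partial>T (snd x)) \<in> borel_measurable (borel \<Otimes>\<^sub>M borel)"
      proof (rule nn_integral_measurable_subprob_algebra2)
        show "(\<lambda>(x, v). path_weight A B j (v(0 := fst x))) \<in> borel_measurable ((borel \<Otimes>\<^sub>M borel) \<Otimes>\<^sub>M PX)"
        proof -
          have proj: "(\<lambda>x. (fst (fst x), snd x)) \<in> (borel \<Otimes>\<^sub>M borel) \<Otimes>\<^sub>M PX \<rightarrow>\<^sub>M borel \<Otimes>\<^sub>M PX"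
            by measurable
          have "(\<lambda>x. path_weight A B j ((snd x)(0 := fst x))) \<in> borel_measurable (borel \<Otimes>\<^sub>M PX)"
            by measurable
          from measurable_compose[OF proj this] show ?thesis
            by (simp only: case_prod_unfold fst_conv snd_conv)
        qed
        show "(\<lambda>x. T (snd x)) \<in> borel \<Otimes>\<^sub>M borel \<rightarrow>\<^sub>M subprob_algebra PX"
          by (rule measurable_compose[OF measurable_snd subprob])
      qed
      thus "(\<lambda>(q, q'). \<integral>\<^sup>+v. path_weight A B j (v(0 := q)) \<partial>T q') \<in> borel_measurable (borel \<Otimes>\<^sub>M borel)"
        by (simp add: case_prod_unfold)
    qed
    \<comment> \<open>The start point joins the proposals as coordinate 0 of a product over
      \<open>insert 0 {1..p}\<close>.\<close>
    also have "\<dots> = (\<integral>\<^sup>+q. \<integral>\<^sup>+u. path_weight A B j u \<partial>(\<Pi>\<^sub>M k\<in>{0..p}. Q q) \<partial>\<mu>\<^sub>0)"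
    proof (rule nn_integral_cong)
      fix q
      interpret product_sigma_finite "\<lambda>_. Q q"
        using prob_space_pcn by unfold_locales
          (meson prob_space_imp_sigma_finite sigma_finite_measure.sigma_finite_countable)
      have I: "{0..p} = insert 0 {1..p}" by auto
      have "path_weight A B j \<in> borel_measurable (\<Pi>\<^sub>M k\<in>insert 0 {1..p}. Q q)"
        using path_weight_measurable[OF A B j] unfolding I[symmetric]
        by (subst measurable_cong_sets[OF sets_PiM_cong refl]) auto
      thus "(\<integral>\<^sup>+q'. \<integral>\<^sup>+v. path_weight A B j (v(0 := q')) \<partial>T q \<partial>Q q) =
          (\<integral>\<^sup>+u. path_weight A B j u \<partial>(\<Pi>\<^sub>M k\<in>{0..p}. Q q))"
        unfolding I by (subst product_nn_integral_insert_rev) auto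
    qed
    finally show ?thesis .
  qed
  have "(\<integral>\<^sup>+q. indicator A q * emeasure (P q) B \<partial>\<mu>) =
      (\<integral>\<^sup>+q. ennreal (dens q) * (indicator A q * emeasure (P q) B) \<partial>\<mu>\<^sub>0)"
    unfolding target_eq by (rule nn_integral_density) measurable
  \<comment> \<open>The factors that depend on the start point alone move inside the integral over
    \<open>V q\<close> and complete \<open>path_weight\<close>.\<close>
  also have "\<dots> = (\<integral>\<^sup>+q. (\<Sum>j=0..p. \<integral>\<^sup>+v. path_weight A B j (v(0 := q)) \<partial>V q) \<partial>\<mu>\<^sub>0)"
  proof (rule nn_integral_cong)
    fix q
    have "ennreal (dens q) * (indicator A q * emeasure (P q) B) =
        (\<Sum>j=0..p. (ennreal (dens q) * indicator A q) *
          (\<integral>\<^sup>+v. ennreal (accept j (v(0 := q))) * indicator B ((v(0 := q)) j) \<partial>V q))"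
      by (simp only: emeasure_mpcn_kernel[OF B] sum_distrib_left mult.assoc)
    also have "\<dots> = (\<Sum>j=0..p. \<integral>\<^sup>+v. path_weight A B j (v(0 := q)) \<partial>V q)"
    proof (rule sum.cong[OF refl])
      fix j assume [measurable]: "j \<in> {0..p}"
      show "(ennreal (dens q) * indicator A q) *
          (\<integral>\<^sup>+v. ennreal (accept j (v(0 := q))) * indicator B ((v(0 := q)) j) \<partial>V q) =
          (\<integral>\<^sup>+v. path_weight A B j (v(0 := q)) \<partial>V q)"
        by (subst nn_integral_cmult[symmetric], measurable)
           (auto intro!: nn_integral_cong simp: path_weight_def ennreal_mult dens_nonneg accept_nonneg ac_simps)
    qed
    finally show "ennreal (dens q) * (indicator A q * emeasure (P q) B) =
        (\<Sum>j=0..p. \<integral>\<^sup>+v. path_weight A B j (v(0 := q)) \<partial>V q)" .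
  qed
  also have "\<dots> = (\<Sum>j=0..p. \<integral>\<^sup>+q. \<integral>\<^sup>+v. path_weight A B j (v(0 := q)) \<partial>V q \<partial>\<mu>\<^sub>0)"
  proof (rule nn_integral_sum)
    fix j assume [measurable]: "j \<in> {0..p}"
    have "(\<lambda>q. \<integral>\<^sup>+v. path_weight A B j (v(0 := q)) \<partial>V q) \<in> borel_measurable borel"
      by (rule nn_integral_measurable_subprob_algebra2[OF _ measurable_prob_algebraD[OF mpcn_proposal_measurable]])
         (unfold case_prod_unfold, measurable)
    thus "(\<lambda>q. \<integral>\<^sup>+v. path_weight A B j (v(0 := q)) \<partial>V q) \<in> borel_measurable \<mu>\<^sub>0"
      by (simp add: measurable_cong_sets[OF sets_ref refl])
  qed
  also have "\<dots> = (\<Sum>j=0..p. \<integral>\<^sup>+q. \<integral>\<^sup>+u. path_weight A B j u \<partial>(\<Pi>\<^sub>M k\<in>{0..p}. Q q) \<partial>\<mu>\<^sub>0)"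
    by (intro sum.cong step refl)
  finally show ?thesis .
qed

text \<open>For a fixed pivot the coordinates are i.i.d., so transposing indices 0 and
  \<open>j\<close> preserves their law, while \<open>path_weight_swap\<close> turns the flow from
  \<open>A\<close> to \<open>B\<close> into that from \<open>B\<close> to \<open>A\<close>. The
  terms thus agree for each \<open>j\<close> separately.\<close>

lemma flow_symmetric:
  assumes A: "A \<in> sets borel" and B: "B \<in> sets borel"
  shows "(\<integral>\<^sup>+q. indicator A q * emeasure (P q) B \<partial>\<mu>) = (\<integral>\<^sup>+q. indicator B q * emeasure (P q) A \<partial>\<mu>)"
proof -
  have swap: "(\<integral>\<^sup>+u. path_weight A B j u \<partial>(\<Pi>\<^sub>M k\<in>{0..p}. Q q)) = (\<integral>\<^sup>+u. path_weight B A j u \<partial>(\<Pi>\<^sub>M k\<in>{0..p}. Q q))"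
    if j: "j \<in> {0..p}" for j q
  proof -
    let ?N = "\<Pi>\<^sub>M k\<in>{0..p}. Q q"
    let ?t = "\<lambda>u. \<lambda>n\<in>{0..p}. u (Transposition.transpose 0 j n)"
    have maps: "Transposition.transpose 0 j n \<in> {0..p}" if "n \<in> {0..p}" for n
      using that j by (auto simp: Transposition.transpose_def)
    have t: "?t \<in> ?N \<rightarrow>\<^sub>M ?N"
      using maps by (intro measurable_restrict) auto
    have pw: "path_weight A B j \<in> borel_measurable ?N"
      using path_weight_measurable[OF A B j] by (subst measurable_cong_sets[OF sets_PiM_cong refl]) auto
    have "distr ?N ?N ?t = ?N"
      using maps prob_space_pcn by (intro distr_PiM_reindex) (auto intro: inj_on_transpose)
    hence "(\<integral>\<^sup>+u. path_weight A B j u \<partial>?N) = (\<integral>\<^sup>+u. path_weight A B j u \<partial>distr ?N ?N ?t)" by simp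
    also have "\<dots> = (\<integral>\<^sup>+u. path_weight A B j (?t u) \<partial>?N)"
      using t pw by (subst nn_integral_distr) auto
    finally show ?thesis unfolding path_weight_swap[OF j] .
  qed
  thus ?thesis unfolding flow_eq[OF A B] flow_eq[OF B A] by (intro sum.cong refl) (simp only: swap)
qed

section \<open>Detailed balance and invariance\<close>

text \<open>Both joint laws are finite, hence determined by their values on measurable rectangles.
  These values are the two flows compared in \<open>flow_symmetric\<close>.\<close>

lemma detailed_balance_mpcn: "detailed_balance \<mu> P"
proof -
  let ?L = "\<lambda>q. P q \<bind> (\<lambda>q'. return (borel \<Otimes>\<^sub>M borel) (q, q'))"
  let ?R = "\<lambda>q'. P q' \<bind> (\<lambda>q. return (borel \<Otimes>\<^sub>M borel) (q, q'))"
  have L: "?L \<in> borel \<rightarrow>\<^sub>M prob_algebra (borel \<Otimes>\<^sub>M borel)" by measurable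
  have R: "?R \<in> borel \<rightarrow>\<^sub>M prob_algebra (borel \<Otimes>\<^sub>M borel)" by measurable
  have on_target: "f \<in> \<mu> \<rightarrow>\<^sub>M subprob_algebra N" if "f \<in> borel \<rightarrow>\<^sub>M prob_algebra N" for f :: "'a \<Rightarrow> 'b measure" and N
    using measurable_prob_algebraD[OF that] by (simp add: measurable_cong_sets[OF sets_target refl])
  have P_space: "P q \<in> space (prob_algebra borel)" for q
    using measurable_space[OF mpcn_kernel_measurable, of q] by simp
  have emeasure_L: "emeasure (\<mu> \<bind> ?L) (A \<times> B) = (\<integral>\<^sup>+q. indicator A q * emeasure (P q) B \<partial>\<mu>)"
    if AB[measurable]: "A \<in> sets borel" "B \<in> sets borel" for A B
  proof -
    have "emeasure (\<mu> \<bind> ?L) (A \<times> B) = (\<integral>\<^sup>+q. emeasure (?L q) (A \<times> B) \<partial>\<mu>)"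
      by (rule emeasure_bind[OF _ on_target[OF L]]) auto
    also have "(\<lambda>q. emeasure (?L q) (A \<times> B)) = (\<lambda>q. indicator A q * emeasure (P q) B)"
    proof
      fix q
      have "emeasure (?L q) (A \<times> B) = (\<integral>\<^sup>+q'. indicator A q * indicator B q' \<partial>P q)"
        by (subst emeasure_bind_prob_algebra[OF P_space, where L = "borel \<Otimes>\<^sub>M borel"])
           (auto simp: indicator_times)
      thus "emeasure (?L q) (A \<times> B) = indicator A q * emeasure (P q) B" by (simp add: nn_integral_cmult)
    qed
    finally show ?thesis .
  qed
  \<comment> \<open>In \<open>?R\<close> the first component is the one drawn from the kernel, so
    \<open>B\<close> restricts the start point and \<open>A\<close> the end point.\<close>
  have emeasure_R: "emeasure (\<mu> \<bind> ?R) (A \<times> B) = (\<integral>\<^sup>+q. indicator B q * emeasure (P q) A \<partial>\<mu>)"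
    if AB[measurable]: "A \<in> sets borel" "B \<in> sets borel" for A B
  proof -
    have "emeasure (\<mu> \<bind> ?R) (A \<times> B) = (\<integral>\<^sup>+q. emeasure (?R q) (A \<times> B) \<partial>\<mu>)"
      by (rule emeasure_bind[OF _ on_target[OF R]]) auto
    also have "(\<lambda>q. emeasure (?R q) (A \<times> B)) = (\<lambda>q. indicator B q * emeasure (P q) A)"
    proof
      fix q
      have "emeasure (?R q) (A \<times> B) = (\<integral>\<^sup>+q'. indicator B q * indicator A q' \<partial>P q)"
        by (subst emeasure_bind_prob_algebra[OF P_space, where L = "borel \<Otimes>\<^sub>M borel"])
           (auto simp: indicator_times mult.commute)
      thus "emeasure (?R q) (A \<times> B) = indicator B q * emeasure (P q) A" by (simp add: nn_integral_cmult)
    qed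
    finally show ?thesis .
  qed
  have "\<mu> \<bind> ?L = \<mu> \<bind> ?R"
  proof (rule measure_eqI_generator_eq[OF Int_stable_pair_measure_generator[of borel borel],
        where \<Omega> = UNIV and A = "\<lambda>_. UNIV"])
    fix X :: "('a \<times> 'a) set" assume "X \<in> {a \<times> b |a b. a \<in> sets borel \<and> b \<in> sets borel}"
    then obtain A B where "X = A \<times> B" "A \<in> sets borel" "B \<in> sets borel" by blast
    thus "emeasure (\<mu> \<bind> ?L) X = emeasure (\<mu> \<bind> ?R) X"
      using flow_symmetric by (simp add: emeasure_L emeasure_R)
  next
    have "sets (?L q) = sets (borel \<Otimes>\<^sub>M borel)" for q
      using measurable_space[OF L, of q] by (simp add: space_prob_algebra)
    hence "sets (\<mu> \<bind> ?L) = sets (borel \<Otimes>\<^sub>M borel)" by (rule sets_bind) simp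
    thus "sets (\<mu> \<bind> ?L) = sigma_sets UNIV {a \<times> b |a b. a \<in> sets borel \<and> b \<in> sets borel}"
      by (simp add: sets_pair_measure)
    have "sets (?R q) = sets (borel \<Otimes>\<^sub>M borel)" for q
      using measurable_space[OF R, of q] by (simp add: space_prob_algebra)
    hence "sets (\<mu> \<bind> ?R) = sets (borel \<Otimes>\<^sub>M borel)" by (rule sets_bind) simp
    thus "sets (\<mu> \<bind> ?R) = sigma_sets UNIV {a \<times> b |a b. a \<in> sets borel \<and> b \<in> sets borel}"
      by (simp add: sets_pair_measure)
    \<comment> \<open>The kernel has mass 1, so the joint law has the finite total mass of
      \<open>\<mu>\<close>; the uniqueness rule requires this for the covering set
      \<open>UNIV\<close>.\<close>
    have "emeasure (\<mu> \<bind> ?L) (UNIV \<times> UNIV) = (\<integral>\<^sup>+q. emeasure (P q) UNIV \<partial>\<mu>)"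
      by (subst emeasure_L) auto
    also have "\<dots> = (\<integral>\<^sup>+q. 1 \<partial>\<mu>)"
      by (simp add: emeasure_mpcn_kernel_UNIV)
    finally show "emeasure (\<mu> \<bind> ?L) UNIV \<noteq> \<infinity>"
      using finite_measure.emeasure_finite[OF finite_target, of UNIV] by simp
  qed (auto intro!: exI[of _ UNIV])
  thus ?thesis unfolding detailed_balance_def .
qed

text \<open>Detailed flow balance with one set equal to the whole space: the flow from everywhere
  into \<open>B\<close> equals the flow from \<open>B\<close> to everywhere, which is the mass of
  \<open>B\<close>.\<close>

lemma invariant_mpcn: "invariant_measure \<mu> P"
proof -
  have P: "P \<in> \<mu> \<rightarrow>\<^sub>M subprob_algebra borel"
    using measurable_prob_algebraD[OF mpcn_kernel_measurable]
    by (simp add: measurable_cong_sets[OF sets_target refl])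
  show ?thesis
    unfolding invariant_measure_def
  proof (rule measure_eqI)
    show sets: "sets (\<mu> \<bind> P) = sets \<mu>" by (subst sets_bind[where N = borel]) auto
    fix B assume "B \<in> sets (\<mu> \<bind> P)"
    hence B[measurable]: "B \<in> sets borel" using sets by simp
    have "emeasure (\<mu> \<bind> P) B = (\<integral>\<^sup>+q. indicator UNIV q * emeasure (P q) B \<partial>\<mu>)"
      using B by (subst emeasure_bind[OF _ P]) auto
    also have "\<dots> = (\<integral>\<^sup>+q. indicator B q * emeasure (P q) UNIV \<partial>\<mu>)"
      using B by (intro flow_symmetric) auto
    also have "\<dots> = emeasure \<mu> B"
      using B by (simp add: emeasure_mpcn_kernel_UNIV)
    finally show "emeasure (\<mu> \<bind> P) B = emeasure \<mu> B" .
  qed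
qed

end

theorem mainTheorem8:
  fixes C :: "'a::{real_inner, polish_space} \<Rightarrow> 'a"
    and \<mu>\<^sub>0 :: "'a measure"
    and \<Phi> :: "'a \<Rightarrow> real"
    and \<rho> :: real
    and p :: nat
  assumes "trace_class C"
    and "symmetric_operator C"
    and "strictly_positive_operator C"
    and "centered_gaussian C \<mu>\<^sub>0"
    and "\<Phi> \<in> borel_measurable borel"
    and "integrable \<mu>\<^sub>0 (\<lambda>q. exp (- \<Phi> q))"
    and "\<rho> \<in> {0..1}"
    and "p \<ge> 1"
  shows "markov_kernel borel (\<Pi>\<^sub>M k\<in>{1..p}. borel) (mpcn_proposal \<mu>\<^sub>0 \<rho> p)
    \<and> markov_kernel borel borel (mpcn_kernel \<mu>\<^sub>0 \<Phi> \<rho> p)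
    \<and> detailed_balance (target_measure \<mu>\<^sub>0 \<Phi>) (mpcn_kernel \<mu>\<^sub>0 \<Phi> \<rho> p)
    \<and> invariant_measure (target_measure \<mu>\<^sub>0 \<Phi>) (mpcn_kernel \<mu>\<^sub>0 \<Phi> \<rho> p)"
proof -
  have "linear C"
    using assms(1) by (simp add: trace_class_def bounded_linear.linear)
  then interpret mpcn C \<mu>\<^sub>0 \<rho> \<Phi> p
    using assms by (intro mpcn.intro gaussian_reference.intro mpcn_axioms.intro)
  show ?thesis
    unfolding markov_kernel_def
    using mpcn_proposal_measurable mpcn_kernel_measurable detailed_balance_mpcn invariant_mpcn by blast
qed

end
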